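(* For every natural number $c$ one can find an integer $S=S(c)$ such that the following holds. Consider the process with initial graph $G^{(0)}=G_S$, thresholds $\alpha=\beta=2$, energy $\mathcal{E}^{(t)}(u,v)=|N_{G^{(t)}}(u)\cap N_{G^{(t)}}(v)|$, and interaction set $C^{(t)}$ consisting of all pairs of distinct vertices at distance at most $2$ in $G^{(t)}$. Then the cycle size of this process is at least $c$.
   Context: For an integer $S\ge1$, $[S]=\{0,\dots,S-1\}$ and $G_S$ is the graph on $[S]\times[S]$ in which $(x,y)$ is adjacent to $(x,y\pm1 \bmod S)$ and $(x\pm1\bmod S,y)$ (the $S\times S$ torus grid). Process: given $G^{(t)}$, the graph $G^{(t+1)}$ on the same vertex set is defined by: for each pair $\{u,v\}\in C^{(t)}$, it is an edge of $G^{(t+1)}$ iff $\mathcal{E}^{(t)}(u,v)\ge 2$; pairs not in $C^{(t)}$ keep their status. Since $G^{(t+1)}$ is a deterministic function of $G^{(t)}$ and there are finitely many graphs on the vertex set, the sequence is eventually periodic; its cycle size is the least $p\ge1$ such that $G^{(t+p)}=G^{(t)}$ for all sufficiently large $t$. *)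

theory Defs
  imports Complex_Main "HOL-Library.Extended_Nat"
begin

text \<open>
  A simple graph on a fixed vertex set is represented by its set of edges, each edge being
  a two-element set of vertices.
\<close>

type_synonym 'a edges = "'a set set"

definition nbhd :: "'a edges \<Rightarrow> 'a \<Rightarrow> 'a set" where
  "nbhd E v = {w. {v, w} \<in> E}"

text \<open>The length of a shortest walk, and \<open>\<infinity>\<close> if there is no walk at all.\<close>

definition graph_dist :: "'a edges \<Rightarrow> 'a \<Rightarrow> 'a \<Rightarrow> enat" where
  "graph_dist E u v = (INF k \<in> {k. (u, v) \<in> {(a, b). {a, b} \<in> E} ^^ k}. enat k)"

definition common_nbrs :: "'a edges \<Rightarrow> 'a \<Rightarrow> 'a \<Rightarrow> nat" where
  "common_nbrs E u v = card (nbhd E u \<inter> nbhd E v)"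

definition pairs_within :: "enat \<Rightarrow> 'a set \<Rightarrow> 'a edges \<Rightarrow> 'a set set" where
  "pairs_within d V E = {{u, v} | u v. u \<in> V \<and> v \<in> V \<and> u \<noteq> v \<and> graph_dist E u v \<le> d}"

text \<open>
  One step of the process when both thresholds have the same value \<open>\<theta>\<close>.  The energy \<open>en\<close> and
  the interaction set \<open>C\<close> are functions of the current graph; \<open>en\<close> is meant to be symmetric
  in its two vertex arguments.
\<close>

definition next_graph ::
  "nat \<Rightarrow> ('a edges \<Rightarrow> 'a \<Rightarrow> 'a \<Rightarrow> nat) \<Rightarrow> ('a edges \<Rightarrow> 'a set set) \<Rightarrow> 'a edges \<Rightarrow> 'a edges" where
  "next_graph \<theta> en C E = {{u, v} | u v. {u, v} \<in> C E \<and> en E u v \<ge> \<theta>} \<union> (E - C E)"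

definition graph_process ::
  "nat \<Rightarrow> ('a edges \<Rightarrow> 'a \<Rightarrow> 'a \<Rightarrow> nat) \<Rightarrow> ('a edges \<Rightarrow> 'a set set) \<Rightarrow> 'a edges \<Rightarrow> nat \<Rightarrow> 'a edges" where
  "graph_process \<theta> en C E0 t = (next_graph \<theta> en C ^^ t) E0"

text \<open>Meaningful for eventually periodic sequences only; see \<open>graph_process_eventually_periodic\<close>.\<close>

definition cycle_size :: "(nat \<Rightarrow> 'b) \<Rightarrow> nat" where
  "cycle_size G = (LEAST p. p \<ge> 1 \<and> (\<exists>T. \<forall>t\<ge>T. G (t + p) = G t))"

definition torus_vertices :: "int \<Rightarrow> (int \<times> int) set" where
  "torus_vertices S = {0..<S} \<times> {0..<S}"

text \<open>
  For \<open>S = 1\<close> the rule relates the only vertex to itself; the condition \<open>u \<noteq> v\<close> discards this loop.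
\<close>

definition torus_grid :: "int \<Rightarrow> (int \<times> int) edges" where
  "torus_grid S = {{u, v} | u v. u \<in> torus_vertices S \<and> u \<noteq> v \<and>
     (case u of (x, y) \<Rightarrow> v \<in> {(x, (y + 1) mod S), (x, (y - 1) mod S),
                             ((x + 1) mod S, y), ((x - 1) mod S, y)})}"

lemma torus_grid_subset: "torus_grid S \<subseteq> Pow (torus_vertices S)"
  by (auto simp: torus_grid_def torus_vertices_def)

lemma graph_process_eventually_periodic:
  assumes "finite V" "E0 \<subseteq> Pow V" "\<And>E. C E \<subseteq> Pow V"
  shows "\<exists>p\<ge>1. \<exists>T. \<forall>t\<ge>T. graph_process \<theta> en C E0 (t + p) = graph_process \<theta> en C E0 t"
proof -
  let ?G = "graph_process \<theta> en C E0"
  have "?G t \<subseteq> Pow V" for t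
  proof (induction t)
    case 0
    then show ?case using assms(2) by (simp add: graph_process_def)
  next
    case (Suc t)
    have "?G (Suc t) \<subseteq> C (?G t) \<union> ?G t"
      by (auto simp: graph_process_def next_graph_def)
    then show ?case using Suc assms(3) by blast
  qed
  then have "range ?G \<subseteq> Pow (Pow V)" by blast
  then have "finite (range ?G)" using assms(1) by (meson finite_Pow_iff finite_subset)
  then have "\<not> inj ?G" using finite_imageD infinite_UNIV_nat by blast
  then obtain i j where ij: "i < j" "?G i = ?G j"
    unfolding inj_def by (metis linorder_neqE_nat)
  have shift: "?G (s + i) = (next_graph \<theta> en C ^^ s) (?G i)" for s i
    by (simp add: graph_process_def funpow_add)
  have "?G (t + (j - i)) = ?G t" if "t \<ge> i" for t
  proof -
    have "?G (t + (j - i)) = ?G ((t - i) + j)" using that ij(1) by simp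
    also have "\<dots> = ?G ((t - i) + i)" by (simp only: shift ij(2))
    finally show ?thesis using that by simp
  qed
  then show ?thesis using ij(1) by (intro exI[of _ "j - i"]) auto
qed

end

theory Submission
  imports Defs "HOL-Library.Product_Plus"
begin

text \<open>
  Every graph of the process is a Cayley graph of \<open>(\<int>/S)\<^sup>2\<close>, so only its connection set \<open>D\<close> has to
  be followed.  The number of common neighbours of \<open>u\<close> and \<open>v\<close> is the number of ordered ways of
  writing \<open>u - v\<close> as a sum of two elements of \<open>D\<close>.  For odd \<open>S\<close> halving is unique, so this number is
  at least two iff \<open>u - v\<close> is a sum of two different elements.  Hence the axis directions
  \<open>k(\<plusminus>1,0), k(0,\<plusminus>1)\<close> become the diagonal directions \<open>k(\<plusminus>1,\<plusminus>1)\<close>, and these become the axis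
  directions with \<open>2k\<close> in place of \<open>k\<close>.  A period is therefore an even number \<open>2q\<close> with
  \<open>2\<^sup>q \<equiv> \<plusminus>1\<close> modulo \<open>S\<close>, which forces \<open>q \<ge> c\<close> when \<open>S = 2\<^sup>c + 1\<close>.
\<close>

section \<open>Congruence modulo \<open>S\<close> and translation-invariant graphs on the
  torus\<close>

definition cong2 :: "int \<Rightarrow> int \<times> int \<Rightarrow> int \<times> int \<Rightarrow> bool" where
  "cong2 S a b \<longleftrightarrow> S dvd fst (a - b) \<and> S dvd snd (a - b)"

text \<open>Connection sets are kept as \<open>S\<close>-periodic subsets of the integer plane
  instead of subsets of the quotient, so the difference of two representatives can be tested for
  membership without reducing it first.\<close>

definition saturation :: "int \<Rightarrow> (int \<times> int) set \<Rightarrow> (int \<times> int) set" where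
  "saturation S F = {d. \<exists>f\<in>F. cong2 S d f}"

definition cayley :: "int \<Rightarrow> (int \<times> int) set \<Rightarrow> (int \<times> int) edges" where
  "cayley S D = {{u, v} | u v. u \<in> torus_vertices S \<and> v \<in> torus_vertices S \<and> u - v \<in> D}"

definition connection_set :: "int \<Rightarrow> (int \<times> int) set \<Rightarrow> bool" where
  "connection_set S D \<longleftrightarrow> saturation S D = D \<and> uminus ` D = D \<and> 0 \<notin> D"

text \<open>Sums congruent to zero are excluded because the process acts only on pairs of distinct
  vertices.\<close>

definition distinct_sums :: "int \<Rightarrow> (int \<times> int) set \<Rightarrow> (int \<times> int) set" where
  "distinct_sums S D = {a + b | a b. a \<in> D \<and> b \<in> D \<and> \<not> cong2 S a b \<and> \<not> cong2 S (a + b) 0}"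

lemma cong2_refl [simp]: "cong2 S a a"
  by (simp add: cong2_def)

lemma cong2_sym: "cong2 S a b \<Longrightarrow> cong2 S b a"
  unfolding cong2_def by (simp add: dvd_diff_commute)

lemma cong2_trans [trans]: "cong2 S a b \<Longrightarrow> cong2 S b c \<Longrightarrow> cong2 S a c"
  using dvd_add[of S "fst (a - b)" "fst (b - c)"] dvd_add[of S "snd (a - b)" "snd (b - c)"]
  by (simp add: cong2_def)

lemma cong2_add: "cong2 S a b \<Longrightarrow> cong2 S c d \<Longrightarrow> cong2 S (a + c) (b + d)"
  using dvd_add[of S "fst (a - b)" "fst (c - d)"] dvd_add[of S "snd (a - b)" "snd (c - d)"]
  by (simp add: cong2_def algebra_simps)

lemma cong2_minus: "cong2 S a b \<Longrightarrow> cong2 S (- a) (- b)"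
  unfolding cong2_def by (simp add: dvd_diff_commute)

lemma cong2_diff: "cong2 S a b \<Longrightarrow> cong2 S c d \<Longrightarrow> cong2 S (a - c) (b - d)"
  using cong2_add[of S a b "- c" "- d"] cong2_minus[of S c d] by simp

lemma cong2_torus_eq:
  assumes "cong2 S u v" "u \<in> torus_vertices S" "v \<in> torus_vertices S"
  shows "u = v"
proof -
  have "fst u mod S = fst v mod S" "snd u mod S = snd v mod S"
    using assms(1) by (simp_all add: cong2_def mod_eq_dvd_iff)
  then show ?thesis
    using assms(2,3) by (auto simp: torus_vertices_def prod_eq_iff)
qed

lemma torus_representative:
  assumes "S \<ge> 1"
  obtains v where "v \<in> torus_vertices S" "cong2 S v w"
proof
  show "(fst w mod S, snd w mod S) \<in> torus_vertices S"
    using assms by (simp add: torus_vertices_def)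
  show "cong2 S (fst w mod S, snd w mod S) w"
    by (simp add: cong2_def flip: mod_eq_dvd_iff)
qed

lemma connection_set_cong2:
  "connection_set S D \<Longrightarrow> cong2 S a b \<Longrightarrow> a \<in> D \<longleftrightarrow> b \<in> D"
  unfolding connection_set_def saturation_def using cong2_sym by blast

lemma connection_set_minus:
  assumes "connection_set S D"
  shows "- a \<in> D \<longleftrightarrow> a \<in> D"
proof -
  have "- b \<in> D" if "b \<in> D" for b
    using assms that unfolding connection_set_def by blast
  from this[of a] this[of "- a"] show ?thesis by auto
qed

lemma connection_set_saturation:
  assumes "uminus ` F = F" "0 \<notin> saturation S F"
  shows "connection_set S (saturation S F)"
proof -
  have neg: "- d \<in> saturation S F" if "d \<in> saturation S F" for d
    using that assms(1) cong2_minus unfolding saturation_def by blast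
  have "uminus ` saturation S F = saturation S F"
    using neg by (force intro: image_eqI[where x = "- _"])
  moreover have "saturation S (saturation S F) = saturation S F"
    unfolding saturation_def using cong2_trans cong2_refl by blast
  ultimately show ?thesis using assms(2) by (simp add: connection_set_def)
qed

lemma edge_cayley_iff:
  assumes "connection_set S D"
  shows "{u, v} \<in> cayley S D \<longleftrightarrow> u \<in> torus_vertices S \<and> v \<in> torus_vertices S \<and> u - v \<in> D"
  using connection_set_minus[OF assms, of "u - v"]
  unfolding cayley_def mem_Collect_eq doubleton_eq_iff minus_diff_eq by blast

text \<open>A residue class belongs to \<open>D\<close> exactly when its representative is joined to
  the origin. This turns an equality of graphs into an equality of connection sets when a period is
  analysed.\<close>

lemma cayley_inject:
  assumes "S \<ge> 1" and D: "connection_set S D" and D': "connection_set S D'"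
    and eq: "cayley S D = cayley S D'"
  shows "D = D'"
proof -
  have "d \<in> D \<longleftrightarrow> d \<in> D'" for d
  proof -
    obtain v where v: "v \<in> torus_vertices S" "cong2 S v d"
      using torus_representative[OF assms(1)] .
    have "(0, 0) \<in> torus_vertices S" using assms(1) by (simp add: torus_vertices_def)
    then have "v \<in> D \<longleftrightarrow> v \<in> D'"
      using edge_cayley_iff[OF D, of v 0] edge_cayley_iff[OF D', of v 0] eq v(1)
      by (simp add: zero_prod_def[symmetric])
    then show ?thesis
      using connection_set_cong2[OF D v(2)] connection_set_cong2[OF D' v(2)] by simp
  qed
  then show ?thesis by blast
qed

section \<open>One step of the process on a Cayley graph\<close>

lemma graph_dist_leI: "(u, v) \<in> {(a, b). {a, b} \<in> E} ^^ k \<Longrightarrow> graph_dist E u v \<le> enat k"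
  unfolding graph_dist_def by (rule INF_lower) simp

lemma edge_in_pairs_within:
  assumes "{u, v} \<in> E" "u \<in> V" "v \<in> V" "u \<noteq> v"
  shows "{u, v} \<in> pairs_within 2 V E"
proof -
  have "graph_dist E u v \<le> enat 1"
    using assms(1) by (intro graph_dist_leI) simp
  then have "graph_dist E u v \<le> 2"
    by (rule order_trans) (simp add: numeral_eq_enat)
  then show ?thesis using assms by (auto simp: pairs_within_def)
qed

lemma common_nbr_in_pairs_within:
  assumes "{u, w} \<in> E" "{v, w} \<in> E" "u \<in> V" "v \<in> V" "u \<noteq> v"
  shows "{u, v} \<in> pairs_within 2 V E"
proof -
  have "(u, v) \<in> {(a, b). {a, b} \<in> E} ^^ 2"
    using assms(1,2) by (auto simp: numeral_2_eq_2 insert_commute)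
  from graph_dist_leI[OF this] have "graph_dist E u v \<le> 2"
    by (simp add: numeral_eq_enat)
  then show ?thesis using assms by (auto simp: pairs_within_def)
qed

lemma two_le_card_iff:
  assumes "finite A"
  shows "2 \<le> card A \<longleftrightarrow> (\<exists>x\<in>A. \<exists>y\<in>A. x \<noteq> y)"
  using card_le_Suc0_iff_eq[OF assms] by (auto simp: not_less_eq_eq numeral_2_eq_2)

lemma cong2_double_cancel:
  assumes "odd S" "cong2 S (a + a) (b + b)"
  shows "cong2 S a b"
proof -
  have "S dvd 2 * fst (a - b)" "S dvd 2 * snd (a - b)"
    using assms(2) by (simp_all add: cong2_def algebra_simps)
  moreover have "coprime S 2" using assms(1) by simp
  ultimately show ?thesis unfolding cong2_def using coprime_dvd_mult_right_iff by blast
qed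

text \<open>A common neighbour \<open>w\<close> corresponds to the decomposition of
  \<open>u - v\<close> into \<open>u - w\<close> and \<open>w - v\<close>. Exchanging two
  incongruent summands yields a second neighbour, while oddness of \<open>S\<close> allows at most
  one decomposition into congruent summands.\<close>

lemma common_nbrs_cayley:
  assumes S: "odd S" "S \<ge> 1" and D: "connection_set S D"
    and uv: "u \<in> torus_vertices S" "v \<in> torus_vertices S" "u \<noteq> v"
  shows "2 \<le> common_nbrs (cayley S D) u v \<longleftrightarrow> u - v \<in> distinct_sums S D"
proof -
  let ?N = "nbhd (cayley S D) u \<inter> nbhd (cayley S D) v"
  have N: "w \<in> ?N \<longleftrightarrow> w \<in> torus_vertices S \<and> u - w \<in> D \<and> w - v \<in> D" for w
    using edge_cayley_iff[OF D] uv connection_set_minus[OF D, of "w - v"]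
    by (auto simp: nbhd_def)
  have fin: "finite ?N"
    by (rule finite_subset[of _ "torus_vertices S"]) (use N in blast, simp add: torus_vertices_def)
  have nz: "\<not> cong2 S (u - v) 0"
    using cong2_torus_eq[of S u v] uv by (auto simp: cong2_def)
  have "(\<exists>x\<in>?N. \<exists>y\<in>?N. x \<noteq> y) \<longleftrightarrow> u - v \<in> distinct_sums S D"
  proof
    assume "\<exists>x\<in>?N. \<exists>y\<in>?N. x \<noteq> y"
    then obtain x y where xy: "x \<in> ?N" "y \<in> ?N" "x \<noteq> y" by blast
    \<comment> \<open>Otherwise every common neighbour is a midpoint of \<open>u\<close> and
      \<open>v\<close>, and midpoints are unique for odd \<open>S\<close>.\<close>
    have "\<exists>w\<in>?N. \<not> cong2 S (u - w) (w - v)"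
    proof (rule ccontr)
      assume "\<not> ?thesis"
      then have *: "cong2 S (u - w) (w - v)" if "w \<in> ?N" for w using that by blast
      have dbl: "cong2 S (w + w) (u + v)" if "w \<in> ?N" for w
        using cong2_add[OF cong2_sym[OF *[OF that]] cong2_refl[of S "v + w"]]
        by (simp add: algebra_simps)
      have "cong2 S x y"
        using cong2_double_cancel[OF S(1) cong2_trans[OF dbl[OF xy(1)] cong2_sym[OF dbl[OF xy(2)]]]] .
      then show False using cong2_torus_eq xy N by blast
    qed
    then obtain w where w: "w \<in> ?N" "\<not> cong2 S (u - w) (w - v)" by blast
    moreover have "u - w \<in> D" "w - v \<in> D" using w(1) N by blast+
    ultimately show "u - v \<in> distinct_sums S D"
      unfolding distinct_sums_def mem_Collect_eq using nz
      by (intro exI[of _ "u - w"] exI[of _ "w - v"]) simp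
  next
    assume "u - v \<in> distinct_sums S D"
    then obtain a b where ab: "u - v = a + b" "a \<in> D" "b \<in> D" "\<not> cong2 S a b"
      unfolding distinct_sums_def by blast
    have nbr: "\<exists>x\<in>?N. cong2 S x (u - a)" if "a \<in> D" "b \<in> D" "u - v = a + b" for a b
    proof -
      obtain x where x: "x \<in> torus_vertices S" "cong2 S x (u - a)"
        using torus_representative[OF S(2)] .
      have "cong2 S (u - x) a" "cong2 S (x - v) b"
        using cong2_diff[OF cong2_refl[of S u] x(2)] cong2_diff[OF x(2) cong2_refl[of S v]] that(3)
        by (simp_all add: algebra_simps)
      then have "u - x \<in> D" "x - v \<in> D" using that(1,2) connection_set_cong2[OF D] by blast+
      then show ?thesis using x N by blast
    qed
    obtain x where x: "x \<in> ?N" "cong2 S x (u - a)" using nbr ab by blast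
    \<comment> \<open>The second neighbour comes from the same two summands in the other
      order.\<close>
    obtain y where y: "y \<in> ?N" "cong2 S y (u - b)" using nbr[of b a] ab by (auto simp: add.commute)
    have "x \<noteq> y"
    proof
      assume "x = y"
      then have "cong2 S (u - a) (u - b)" using x y cong2_sym cong2_trans by blast
      from cong2_diff[OF cong2_refl[of S u] this] show False using ab(4) by simp
    qed
    then show "\<exists>x\<in>?N. \<exists>y\<in>?N. x \<noteq> y" using x y by blast
  qed
  then show ?thesis by (simp add: common_nbrs_def two_le_card_iff[OF fin])
qed

text \<open>Every edge lies in the interaction set, so no edge survives merely by keeping its
  status. A pair of energy at least two has a common neighbour and hence lies in the set as well, so
  the energy alone decides the next graph.\<close>

lemma next_graph_cayley:
  assumes S: "odd S" "S \<ge> 1" and D: "connection_set S D"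
  shows "next_graph 2 common_nbrs (pairs_within 2 (torus_vertices S)) (cayley S D) =
    cayley S (distinct_sums S D)"
proof -
  let ?E = "cayley S D" and ?V = "torus_vertices S"
  have "e \<in> pairs_within 2 ?V ?E" if "e \<in> ?E" for e
  proof -
    obtain u v where e: "e = {u, v}" "u \<in> ?V" "v \<in> ?V" "u - v \<in> D"
      using \<open>e \<in> ?E\<close> unfolding cayley_def by blast
    then have "u \<noteq> v" using D by (auto simp: connection_set_def)
    then show ?thesis
      unfolding e(1) using e that by (intro edge_in_pairs_within) simp_all
  qed
  then have no_other: "?E - pairs_within 2 ?V ?E = {}" by blast
  have edge_iff: "{u, v} \<in> pairs_within 2 ?V ?E \<and> 2 \<le> common_nbrs ?E u v \<longleftrightarrow>
      u \<in> ?V \<and> v \<in> ?V \<and> u - v \<in> distinct_sums S D" for u v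
  proof
    assume l: "{u, v} \<in> pairs_within 2 ?V ?E \<and> 2 \<le> common_nbrs ?E u v"
    then have "u \<in> ?V \<and> v \<in> ?V \<and> u \<noteq> v"
      by (auto simp: pairs_within_def doubleton_eq_iff)
    then show "u \<in> ?V \<and> v \<in> ?V \<and> u - v \<in> distinct_sums S D"
      using l common_nbrs_cayley[OF S D] by blast
  next
    assume r: "u \<in> ?V \<and> v \<in> ?V \<and> u - v \<in> distinct_sums S D"
    then have "u \<noteq> v" by (auto simp: distinct_sums_def)
    with r have two: "2 \<le> common_nbrs ?E u v" using common_nbrs_cayley[OF S D] by blast
    then have "nbhd ?E u \<inter> nbhd ?E v \<noteq> {}" by (auto simp: common_nbrs_def)
    then obtain w where "{u, w} \<in> ?E" "{v, w} \<in> ?E" by (auto simp: nbhd_def)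
    then have "{u, v} \<in> pairs_within 2 ?V ?E"
      using r \<open>u \<noteq> v\<close> by (intro common_nbr_in_pairs_within) simp_all
    then show "{u, v} \<in> pairs_within 2 ?V ?E \<and> 2 \<le> common_nbrs ?E u v"
      using two by simp
  qed
  show ?thesis
    unfolding next_graph_def edge_iff no_other Un_empty_right
    by (rule cayley_def[symmetric])
qed

section \<open>The axis and diagonal connection sets\<close>

definition axis_set :: "int \<Rightarrow> int \<Rightarrow> (int \<times> int) set" where
  "axis_set S k = saturation S {(k, 0), (- k, 0), (0, k), (0, - k)}"

definition diagonal_set :: "int \<Rightarrow> int \<Rightarrow> (int \<times> int) set" where
  "diagonal_set S k = saturation S {(k, k), (- k, - k), (k, - k), (- k, k)}"

lemma connection_set_axis_set: "\<not> S dvd k \<Longrightarrow> connection_set S (axis_set S k)"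
  unfolding axis_set_def
  by (rule connection_set_saturation) (auto simp: saturation_def cong2_def)

lemma connection_set_diagonal_set: "\<not> S dvd k \<Longrightarrow> connection_set S (diagonal_set S k)"
  unfolding diagonal_set_def
  by (rule connection_set_saturation) (auto simp: saturation_def cong2_def)

text \<open>Both side conditions are invariant under congruence, so the sums need only be computed
  on the finitely many generators.\<close>

lemma distinct_sums_saturation:
  "distinct_sums S (saturation S F) =
    saturation S {a + b | a b. a \<in> F \<and> b \<in> F \<and> \<not> cong2 S a b \<and> \<not> cong2 S (a + b) 0}"
    (is "?L = saturation S ?R")
proof (intro equalityI subsetI)
  fix d assume "d \<in> ?L"
  then obtain a b f g where d: "d = a + b" and ab: "\<not> cong2 S a b" "\<not> cong2 S (a + b) 0"
    and fg: "f \<in> F" "g \<in> F" "cong2 S a f" "cong2 S b g"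
    unfolding distinct_sums_def saturation_def by blast
  have "\<not> cong2 S f g" using ab fg cong2_sym cong2_trans by metis
  moreover have s: "cong2 S d (f + g)" unfolding d using fg cong2_add by blast
  then have "\<not> cong2 S (f + g) 0" using ab d cong2_trans by metis
  ultimately show "d \<in> saturation S ?R" using s fg unfolding saturation_def by blast
next
  fix d assume "d \<in> saturation S ?R"
  then obtain f g where d: "cong2 S d (f + g)" and fg: "f \<in> F" "g \<in> F"
    and ne: "\<not> cong2 S f g" "\<not> cong2 S (f + g) 0"
    unfolding saturation_def by blast
  \<comment> \<open>The first summand is taken to be \<open>d - g\<close> rather than
    \<open>f\<close>, so that the sum is exactly \<open>d\<close>.\<close>
  have c: "cong2 S (d - g) f" using cong2_diff[OF d cong2_refl[of S g]] by simp
  have "\<not> cong2 S (d - g) g" using c ne cong2_sym cong2_trans by metis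
  moreover have "\<not> cong2 S d 0" using d ne cong2_sym cong2_trans by metis
  moreover have "d = (d - g) + g" by simp
  ultimately show "d \<in> ?L" using c fg unfolding distinct_sums_def saturation_def
    by (smt (verit, best) cong2_refl mem_Collect_eq)
qed

text \<open>Equal generators and opposite generators are ruled out by the two side conditions;
  perpendicular ones add up to the diagonals. The hypothesis makes perpendicular generators
  incongruent and their sum nonzero modulo \<open>S\<close>.\<close>

lemma distinct_sums_axis_set:
  assumes "\<not> S dvd k"
  shows "distinct_sums S (axis_set S k) = diagonal_set S k"
proof -
  let ?F = "{(k, 0), (- k, 0), (0, k), (0, - k)}"
  have "{a + b | a b. a \<in> ?F \<and> b \<in> ?F \<and> \<not> cong2 S a b \<and> \<not> cong2 S (a + b) 0} =
      {(k, k), (- k, - k), (k, - k), (- k, k)}"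
  proof (intro equalityI subsetI)
    fix d assume "d \<in> {(k, k), (- k, - k), (k, - k), (- k, k)}"
    then consider "d = (k, 0) + (0, k)" | "d = (- k, 0) + (0, - k)"
      | "d = (k, 0) + (0, - k)" | "d = (- k, 0) + (0, k)"
      by auto
    then show "d \<in> {a + b | a b. a \<in> ?F \<and> b \<in> ?F \<and> \<not> cong2 S a b \<and> \<not> cong2 S (a + b) 0}"
      by cases (use assms in \<open>force simp: cong2_def\<close>)+
  next
    fix d assume "d \<in> {a + b | a b. a \<in> ?F \<and> b \<in> ?F \<and> \<not> cong2 S a b \<and> \<not> cong2 S (a + b) 0}"
    then obtain a b where d: "d = a + b" and ab: "a \<in> ?F" "b \<in> ?F"
      and "\<not> cong2 S a b" "\<not> cong2 S d 0"
      by blast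
    then have "a \<noteq> b" "d \<noteq> 0" by auto
    with ab show "d \<in> {(k, k), (- k, - k), (k, - k), (- k, k)}"
      unfolding d by (elim insertE) (simp_all add: zero_prod_def)
  qed
  then show ?thesis
    unfolding axis_set_def diagonal_set_def distinct_sums_saturation
    by (rule arg_cong[where f = "saturation S"])
qed

text \<open>Again only perpendicular generators contribute. They differ by \<open>2 * k\<close> or
  its negative in one coordinate, and so does their sum from zero, which is why the hypothesis
  concerns \<open>2 * k\<close>.\<close>

lemma distinct_sums_diagonal_set:
  assumes "\<not> S dvd 2 * k"
  shows "distinct_sums S (diagonal_set S k) = axis_set S (2 * k)"
proof -
  let ?F = "{(k, k), (- k, - k), (k, - k), (- k, k)}"
  have dbl: "\<not> S dvd k + k" "\<not> S dvd - k - k"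
    using assms dvd_minus_iff[of S "2 * k"] by simp_all
  have "{a + b | a b. a \<in> ?F \<and> b \<in> ?F \<and> \<not> cong2 S a b \<and> \<not> cong2 S (a + b) 0} =
      {(2 * k, 0), (- (2 * k), 0), (0, 2 * k), (0, - (2 * k))}"
  proof (intro equalityI subsetI)
    fix d assume "d \<in> {(2 * k, 0), (- (2 * k), 0), (0, 2 * k), (0, - (2 * k))}"
    then consider "d = (k, k) + (k, - k)" | "d = (- k, - k) + (- k, k)"
      | "d = (k, k) + (- k, k)" | "d = (- k, - k) + (k, - k)"
      by auto
    then show "d \<in> {a + b | a b. a \<in> ?F \<and> b \<in> ?F \<and> \<not> cong2 S a b \<and> \<not> cong2 S (a + b) 0}"
      by cases (use dbl in \<open>force simp: cong2_def\<close>)+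
  next
    fix d assume "d \<in> {a + b | a b. a \<in> ?F \<and> b \<in> ?F \<and> \<not> cong2 S a b \<and> \<not> cong2 S (a + b) 0}"
    then obtain a b where d: "d = a + b" and ab: "a \<in> ?F" "b \<in> ?F"
      and "\<not> cong2 S a b" "\<not> cong2 S d 0"
      by blast
    then have "a \<noteq> b" "d \<noteq> 0" by auto
    with ab show "d \<in> {(2 * k, 0), (- (2 * k), 0), (0, 2 * k), (0, - (2 * k))}"
      unfolding d by (elim insertE) (simp_all add: zero_prod_def)
  qed
  then show ?thesis
    unfolding axis_set_def diagonal_set_def distinct_sums_saturation
    by (rule arg_cong[where f = "saturation S"])
qed

lemma torus_grid_eq_cayley:
  assumes "S \<ge> 3"
  shows "torus_grid S = cayley S (axis_set S 1)"
proof -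
  have mod_iff: "b = (a + k) mod S \<longleftrightarrow> S dvd a - b + k" if "b \<in> {0..<S}" for a b k
  proof -
    have "b = (a + k) mod S \<longleftrightarrow> (a + k) mod S = b mod S" using that by auto
    then show ?thesis by (simp add: mod_eq_dvd_iff algebra_simps)
  qed
  have eq_iff: "b = a \<longleftrightarrow> S dvd a - b" if "a \<in> {0..<S}" "b \<in> {0..<S}" for a b
    using mod_iff[OF that(2), of a 0] that by auto
  have adj: "u \<in> torus_vertices S \<and> u \<noteq> v \<and>
     (case u of (x, y) \<Rightarrow> v \<in> {(x, (y + 1) mod S), (x, (y - 1) mod S),
                             ((x + 1) mod S, y), ((x - 1) mod S, y)}) \<longleftrightarrow>
    u \<in> torus_vertices S \<and> v \<in> torus_vertices S \<and> u - v \<in> axis_set S 1" (is "?l \<longleftrightarrow> ?r") for u v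
  proof (cases "u \<in> torus_vertices S \<and> v \<in> torus_vertices S")
    case True
    obtain x y x' y' where [simp]: "u = (x, y)" "v = (x', y')" by (cases u, cases v)
    have V: "x \<in> {0..<S}" "y \<in> {0..<S}" "x' \<in> {0..<S}" "y' \<in> {0..<S}"
      using True by (auto simp: torus_vertices_def)
    have ndvd: "\<not> S dvd 1" using assms by (auto dest: zdvd_imp_le)
    \<comment> \<open>Writing \<open>+ - 1\<close> lets \<open>mod_iff\<close> apply to both
      directions; all conditions then become divisibility statements.\<close>
    have "u - v \<in> axis_set S 1 \<longleftrightarrow>
        x' = x \<and> (y' = (y + 1) mod S \<or> y' = (y + - 1) mod S) \<or>
        y' = y \<and> (x' = (x + 1) mod S \<or> x' = (x + - 1) mod S)"
      unfolding mod_iff[OF V(3)] mod_iff[OF V(4)] eq_iff[OF V(1,3)] eq_iff[OF V(2,4)]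
      by (auto simp: axis_set_def saturation_def cong2_def)
    moreover have "u \<noteq> v" if "u - v \<in> axis_set S 1"
      using that connection_set_axis_set[OF ndvd] by (auto simp: connection_set_def zero_prod_def)
    ultimately show ?thesis using True by auto
  next
    case False
    have "v \<in> torus_vertices S" if ?l
      using that assms by (auto simp: torus_vertices_def)
    then show ?thesis using False by blast
  qed
  show ?thesis unfolding torus_grid_def cayley_def adj ..
qed

section \<open>The period for \<open>S = 2 ^ c + 1\<close>\<close>

theorem theorem4:
  fixes c :: nat
  shows "\<exists>S::int. S \<ge> 1 \<and>
    cycle_size (graph_process 2 common_nbrs (pairs_within 2 (torus_vertices S)) (torus_grid S)) \<ge> c"
proof (cases "c = 0")
  case True
  \<comment> \<open>For \<open>c = 0\<close> the modulus \<open>2 ^ c + 1\<close> would be even, but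
    the bound is trivial.\<close>
  then show ?thesis by (intro exI[of _ 1]) simp
next
  case False
  define S :: int where "S = 2 ^ c + 1"
  have "(2::int) ^ 1 \<le> 2 ^ c" using False by (intro power_increasing) auto
  then have S3: "S \<ge> 3" by (simp add: S_def)
  have S1: "S \<ge> 1" using S3 by simp
  have odd: "odd S" using False by (simp add: S_def)
  have cop: "coprime S (2 ^ k)" for k using odd by simp
  \<comment> \<open>No power of two vanishes modulo \<open>S\<close>, so the doubling never
    collapses and both step rules apply at all times.\<close>
  have nd: "\<not> S dvd 2 ^ k" for k
  proof
    assume "S dvd 2 ^ k"
    then have "is_unit S" using cop[of k] by (meson coprime_common_divisor dvd_refl)
    then show False using S3 by simp
  qed
  define C where "C = pairs_within 2 (torus_vertices S)"
  define G where "G = graph_process 2 common_nbrs C (torus_grid S)"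
  have G_Suc: "G (Suc t) = next_graph 2 common_nbrs C (G t)" for t
    by (simp add: G_def graph_process_def)
  have step_axis: "next_graph 2 common_nbrs C (cayley S (axis_set S (2 ^ k))) =
      cayley S (diagonal_set S (2 ^ k))" for k
    using next_graph_cayley[OF odd S1 connection_set_axis_set[OF nd]]
      distinct_sums_axis_set[OF nd] by (simp add: C_def)
  have step_diagonal: "next_graph 2 common_nbrs C (cayley S (diagonal_set S (2 ^ k))) =
      cayley S (axis_set S (2 ^ Suc k))" for k
    using next_graph_cayley[OF odd S1 connection_set_diagonal_set[OF nd[of k]]]
      distinct_sums_diagonal_set[of S "2 ^ k"] nd[of "Suc k"] by (simp add: C_def)
  have even_graph: "G (2 * k) = cayley S (axis_set S (2 ^ k))" for k
  proof (induction k)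
    case 0
    then show ?case by (simp add: G_def graph_process_def torus_grid_eq_cayley[OF S3])
  next
    case (Suc k)
    then show ?case using step_axis[of k] step_diagonal[of k] by (simp add: G_Suc)
  qed
  have odd_graph: "G (Suc (2 * k)) = cayley S (diagonal_set S (2 ^ k))" for k
    using even_graph[of k] step_axis[of k] by (simp add: G_Suc)
  have period: "c \<le> p" if p: "p \<ge> 1" "\<forall>t\<ge>T. G (t + p) = G t" for p T
  proof -
    \<comment> \<open>The time \<open>2 * T\<close> is at least \<open>T\<close> and even, so the
      graph there is an axis graph.\<close>
    have eq: "G (2 * T + p) = G (2 * T)" using p(2) by simp
    have mem: "(2 ^ T, 0) \<in> axis_set S (2 ^ T)" by (simp add: axis_set_def saturation_def)
    show ?thesis
    proof (cases "even p")
      case True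
      then obtain q where q: "p = 2 * q" by (elim evenE)
      have "cayley S (axis_set S (2 ^ (T + q))) = cayley S (axis_set S (2 ^ T))"
        using eq even_graph[of T] even_graph[of "T + q"] by (simp add: q)
      then have "axis_set S (2 ^ (T + q)) = axis_set S (2 ^ T)"
        by (intro cayley_inject[OF S1] connection_set_axis_set nd)
      with mem have "(2 ^ T, 0) \<in> axis_set S (2 ^ (T + q))" by simp
      \<comment> \<open>The vertical generators cannot match, since their first coordinate is zero
        and \<open>2 ^ T\<close> is not zero modulo \<open>S\<close>.\<close>
      then have "S dvd 2 ^ T - 2 ^ (T + q) \<or> S dvd 2 ^ T + 2 ^ (T + q)"
        using nd[of T] by (auto simp: axis_set_def saturation_def cong2_def)
      then have "S dvd 2 ^ T * (2 ^ q - 1) \<or> S dvd 2 ^ T * (2 ^ q + 1)"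
        by (simp add: algebra_simps power_add dvd_diff_commute)
      then have "S dvd 2 ^ q - 1 \<or> S dvd 2 ^ q + 1"
        using cop[of T] by (simp add: coprime_dvd_mult_right_iff)
      \<comment> \<open>As \<open>p\<close> is positive, so is \<open>q\<close>; thus
        \<open>2 ^ q - 1\<close> is positive and divisibility by \<open>S\<close> bounds
        \<open>S\<close> in both cases.\<close>
      moreover have "(2::int) ^ 1 \<le> 2 ^ q" using p(1) q by (intro power_increasing) auto
      ultimately have "S \<le> 2 ^ q + 1" by (auto dest: zdvd_imp_le)
      then have "(2::int) ^ c \<le> 2 ^ q" by (simp add: S_def)
      then have "c \<le> q" by (rule power_le_imp_le_exp[rotated]) simp
      then show ?thesis using q by simp
    next
      case False
      then obtain q where q: "p = Suc (2 * q)" by (elim oddE) simp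
      have "cayley S (diagonal_set S (2 ^ (T + q))) = cayley S (axis_set S (2 ^ T))"
        using eq even_graph[of T] odd_graph[of "T + q"] by (simp add: q)
      then have "diagonal_set S (2 ^ (T + q)) = axis_set S (2 ^ T)"
        by (intro cayley_inject[OF S1] connection_set_axis_set connection_set_diagonal_set nd)
      with mem have "(2 ^ T, 0) \<in> diagonal_set S (2 ^ (T + q))" by simp
      \<comment> \<open>An odd period is impossible: the axis vector has a zero coordinate, but both
        coordinates of a diagonal generator are nonzero modulo \<open>S\<close>.\<close>
      then show ?thesis
        using nd[of "T + q"] by (auto simp: diagonal_set_def saturation_def cong2_def)
    qed
  qed
  \<comment> \<open>Existence of some period ensures that the \<open>LEAST\<close> in
    \<open>cycle_size\<close> is itself a period, to which the lower bound applies.\<close>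
  have "\<exists>p\<ge>1. \<exists>T. \<forall>t\<ge>T. G (t + p) = G t"
    unfolding G_def
  proof (rule graph_process_eventually_periodic[OF _ torus_grid_subset])
    show "finite (torus_vertices S)" by (simp add: torus_vertices_def)
    show "C E \<subseteq> Pow (torus_vertices S)" for E by (auto simp: C_def pairs_within_def)
  qed
  then have "\<exists>p. p \<ge> 1 \<and> (\<exists>T. \<forall>t\<ge>T. G (t + p) = G t)" by blast
  from LeastI_ex[OF this] have "c \<le> cycle_size G"
    unfolding cycle_size_def using period by blast
  then show ?thesis using S1 by (auto simp: G_def C_def)
qed

end
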